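(* Let $r\in\mathbb{R}$ and let $\sigma_\hbar\in S^r_{0,0}(\hbar\mathbb{Z}^n\times\mathbb{T}^n)$. Then the semi-classical pseudo-differential operator $\mathrm{Op}_\hbar(\sigma_\hbar)$ is bounded from $\ell^2_s(\hbar\mathbb{Z}^n)$ to $\ell^2_{s-r}(\hbar\mathbb{Z}^n)$ for all $s\in\mathbb{R}$.
   Context: Fix $n\ge1$ and $\hbar\in(0,1]$. $\hbar\mathbb{Z}^n=\{\hbar\bar k:\bar k\in\mathbb{Z}^n\}\subset\mathbb{R}^n$, $|k|$ is the Euclidean norm, $\mathbb{T}^n=\mathbb{R}^n/\mathbb{Z}^n$ with normalized Haar measure, $k\cdot\theta=\sum_jk_j\theta_j$. Semi-classical Fourier transform: $\widehat f(\theta)=\sum_{k\in\hbar\mathbb{Z}^n}e^{-2\pi\frac{i}{\hbar}k\cdot\theta}f(k)$. Quantization: $\mathrm{Op}_\hbar(\sigma_\hbar)f(k)=\int_{\mathbb{T}^n}e^{2\pi\frac{i}{\hbar}k\cdot\theta}\sigma_\hbar(k,\theta)\widehat f(\theta)\,d\theta=\sum_{m\in\hbar\mathbb{Z}^n}K(k,m)f(m)$ with $K(k,m)=\int_{\mathbb{T}^n}e^{2\pi\frac{i}{\hbar}(k-m)\cdot\theta}\sigma_\hbar(k,\theta)\,d\theta$; the kernel form gives the meaning on $\ell^2_s$. Difference operators: with $v_j$ the $j$-th standard unit vector, $\Delta_{\hbar,j}g(k)=\frac{g(k+\hbar v_j)-g(k)}{\hbar}$, $\Delta_\hbar^\alpha=\Delta_{\hbar,1}^{\alpha_1}\cdots\Delta_{\hbar,n}^{\alpha_n}$.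 Toroidal operators: $D_{\hbar,\theta}^{(\beta)}=\hbar^{|\beta|}\prod_{j=1}^n\prod_{\ell=0}^{\beta_j-1}\big(\frac{1}{2\pi i}\frac{\partial}{\partial\theta_j}-\ell\big)$. $S^r_{0,0}(\hbar\mathbb{Z}^n\times\mathbb{T}^n)$ is the set of $\sigma_\hbar:\hbar\mathbb{Z}^n\times\mathbb{T}^n\to\mathbb{C}$, smooth in $\theta$, such that for all $\alpha,\beta\in\mathbb{N}_0^n$ there is $C_{\alpha,\beta}$ with $|D^{(\beta)}_{\hbar,\theta}\Delta^\alpha_{\hbar,k}\sigma_\hbar(k,\theta)|\le C_{\alpha,\beta}(1+|k|)^r$ for all $(k,\theta)$. Weighted space: $\ell^2_s(\hbar\mathbb{Z}^n)$ is the space of $f:\hbar\mathbb{Z}^n\to\mathbb{C}$ with $\|f\|_{\ell^2_s}=\big(\sum_k(1+|k|)^{2s}|f(k)|^2\big)^{1/2}<\infty$. *)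

theory Defs
  imports "HOL-Analysis.Analysis"
begin

definition int_lattice :: "(real ^ 'n) set" where
  "int_lattice = {z. \<forall>i. z $ i \<in> \<int>}"

definition hlattice :: "real \<Rightarrow> (real ^ 'n) set" where
  "hlattice h = {h *\<^sub>R z | z. z \<in> int_lattice}"

text \<open>
  Functions on the lattice \<open>hlattice h\<close> are represented by functions on \<open>real ^ 'n\<close> whose values
  off the lattice are never used. Functions on the torus are represented by functions on
  \<open>real ^ 'n\<close> that are periodic with respect to \<open>int_lattice\<close>; integration against the normalized
  Haar measure is then integration over the unit cube \<open>cbox 0 1\<close>.
\<close>

definition torus_periodic :: "(real ^ 'n \<Rightarrow> 'b) \<Rightarrow> bool" where
  "torus_periodic g \<longleftrightarrow> (\<forall>\<theta>. \<forall>z\<in>int_lattice. g (\<theta> + z) = g \<theta>)"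

definition partial_deriv :: "'n::finite \<Rightarrow> (real ^ 'n \<Rightarrow> complex) \<Rightarrow> real ^ 'n \<Rightarrow> complex" where
  "partial_deriv j g \<theta> = vector_derivative (\<lambda>t. g (\<theta> + t *\<^sub>R axis j 1)) (at 0)"

definition has_partials :: "(real ^ 'n::finite \<Rightarrow> complex) \<Rightarrow> bool" where
  "has_partials g \<longleftrightarrow> (\<forall>\<theta> j. (\<lambda>t. g (\<theta> + t *\<^sub>R axis j 1)) differentiable (at 0))"

text \<open>All iterated partial derivatives, of every order, exist everywhere and are continuous.\<close>

definition smooth_fun :: "(real ^ 'n::finite \<Rightarrow> complex) \<Rightarrow> bool" where
  "smooth_fun g \<longleftrightarrow>
     (\<forall>js. has_partials (foldr partial_deriv js g) \<and>
           continuous_on UNIV (foldr partial_deriv js g))"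

text \<open>
  An enumeration of the coordinates, used to write compositions of operators over all coordinates.
  The operators composed below commute (the difference operators always, the toroidal ones on
  smooth functions), so the choice of enumeration does not matter.
\<close>

definition coords :: "'n::finite list" where
  "coords = (SOME js. distinct js \<and> set js = UNIV)"

definition diff_op ::
  "real \<Rightarrow> 'n::finite \<Rightarrow> (real ^ 'n \<Rightarrow> complex) \<Rightarrow> real ^ 'n \<Rightarrow> complex" where
  "diff_op h j g k = (g (k + h *\<^sub>R axis j 1) - g k) / of_real h"

definition diff_op_multi ::
  "real \<Rightarrow> ('n::finite \<Rightarrow> nat) \<Rightarrow> (real ^ 'n \<Rightarrow> complex) \<Rightarrow> real ^ 'n \<Rightarrow> complex" where
  "diff_op_multi h \<alpha> g = foldr (\<lambda>j. diff_op h j ^^ \<alpha> j) coords g"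

definition toroidal_factor ::
  "'n::finite \<Rightarrow> nat \<Rightarrow> (real ^ 'n \<Rightarrow> complex) \<Rightarrow> real ^ 'n \<Rightarrow> complex" where
  "toroidal_factor j l g \<theta> = partial_deriv j g \<theta> / (2 * of_real pi * \<i>) - of_nat l * g \<theta>"

definition toroidal_op ::
  "real \<Rightarrow> ('n::finite \<Rightarrow> nat) \<Rightarrow> (real ^ 'n \<Rightarrow> complex) \<Rightarrow> real ^ 'n \<Rightarrow> complex" where
  "toroidal_op h \<beta> g \<theta> =
     of_real (h ^ (\<Sum>j\<in>UNIV. \<beta> j)) *
     foldr (\<lambda>j. foldr (toroidal_factor j) [0..<\<beta> j]) coords g \<theta>"

definition symbol_class :: "real \<Rightarrow> real \<Rightarrow> (real ^ 'n::finite \<Rightarrow> real ^ 'n \<Rightarrow> complex) set" where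
  "symbol_class h r =
     {\<sigma>. (\<forall>k\<in>hlattice h. torus_periodic (\<sigma> k) \<and> smooth_fun (\<sigma> k)) \<and>
         (\<forall>\<alpha> \<beta>. \<exists>C. \<forall>k\<in>hlattice h. \<forall>\<theta>.
            cmod (toroidal_op h \<beta> (\<lambda>\<theta>'. diff_op_multi h \<alpha> (\<lambda>k'. \<sigma> k' \<theta>') k) \<theta>)
              \<le> C * (1 + norm k) powr r)}"

definition op_kernel ::
  "real \<Rightarrow> (real ^ 'n::finite \<Rightarrow> real ^ 'n \<Rightarrow> complex) \<Rightarrow> real ^ 'n \<Rightarrow> real ^ 'n \<Rightarrow> complex" where
  "op_kernel h \<sigma> k m =
     integral (cbox 0 1) (\<lambda>\<theta>. exp (2 * of_real pi * (\<i> / of_real h) * of_real ((k - m) \<bullet> \<theta>)) * \<sigma> k \<theta>)"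

text \<open>
  The kernel form of the quantization, which is what gives it a meaning on weighted spaces.
  Note that \<open>infsum\<close> is 0 on families that are not summable, so well-definedness on a given
  space is a separate statement, \<open>Op_defined_on\<close>.
\<close>

definition Op ::
  "real \<Rightarrow> (real ^ 'n::finite \<Rightarrow> real ^ 'n \<Rightarrow> complex) \<Rightarrow>
   (real ^ 'n \<Rightarrow> complex) \<Rightarrow> real ^ 'n \<Rightarrow> complex" where
  "Op h \<sigma> f k = (\<Sum>\<^sub>\<infinity>m\<in>hlattice h. op_kernel h \<sigma> k m * f m)"

definition Op_defined_on ::
  "real \<Rightarrow> (real ^ 'n::finite \<Rightarrow> real ^ 'n \<Rightarrow> complex) \<Rightarrow> (real ^ 'n \<Rightarrow> complex) set \<Rightarrow> bool" where
  "Op_defined_on h \<sigma> F \<longleftrightarrow>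
     (\<forall>f\<in>F. \<forall>k\<in>hlattice h. (\<lambda>m. op_kernel h \<sigma> k m * f m) summable_on hlattice h)"

definition weighted_l2 :: "real \<Rightarrow> real \<Rightarrow> (real ^ 'n::finite \<Rightarrow> complex) set" where
  "weighted_l2 h s =
     {f. (\<lambda>k. (1 + norm k) powr (2 * s) * (cmod (f k))\<^sup>2) summable_on hlattice h}"

definition weighted_l2_norm :: "real \<Rightarrow> real \<Rightarrow> (real ^ 'n::finite \<Rightarrow> complex) \<Rightarrow> real" where
  "weighted_l2_norm h s f =
     sqrt (\<Sum>\<^sub>\<infinity>k\<in>hlattice h. (1 + norm k) powr (2 * s) * (cmod (f k))\<^sup>2)"

definition bounded_weighted_l2 ::
  "real \<Rightarrow> real \<Rightarrow> real \<Rightarrow> ((real ^ 'n::finite \<Rightarrow> complex) \<Rightarrow> real ^ 'n \<Rightarrow> complex) \<Rightarrow> bool" where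
  "bounded_weighted_l2 h s t T \<longleftrightarrow>
     (\<forall>f\<in>weighted_l2 h s. \<forall>g\<in>weighted_l2 h s. \<forall>k\<in>hlattice h.
        T (\<lambda>m. f m + g m) k = T f k + T g k) \<and>
     (\<forall>c. \<forall>f\<in>weighted_l2 h s. \<forall>k\<in>hlattice h. T (\<lambda>m. c * f m) k = c * T f k) \<and>
     (\<exists>C. \<forall>f\<in>weighted_l2 h s.
        T f \<in> weighted_l2 h t \<and> weighted_l2_norm h t (T f) \<le> C * weighted_l2_norm h s f)"

end

theory Submission
  imports Defs
begin

text \<open>
  At a lattice pair \<open>(k, m)\<close> the kernel is the Fourier coefficient of \<open>\<sigma> k\<close> at the integer
  frequency \<open>p = (k - m) / h\<close>. A toroidal factor in \<open>\<theta>\<^sub>j\<close> multiplies this coefficient by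
  \<open>- (p\<^sub>j + l)\<close>, so the symbol estimates without any differences in \<open>k\<close> already give
  \<open>(1 + \<bar>p\<bar>)\<^sup>N \<bar>K(k, m)\<bar> \<le> C (1 + \<bar>k\<bar>)\<^sup>r\<close> for every \<open>N\<close>. By Peetre's inequality, and since
  \<open>\<bar>k - m\<bar> \<le> \<bar>p\<bar>\<close> for \<open>h \<le> 1\<close>, conjugating with the weights costs only \<open>\<bar>s\<bar>\<close> of these powers; the
  conjugated kernel is dominated by a summable function of \<open>p\<close> and the Schur test applies.
\<close>

section \<open>Schur test and lattice sums\<close>

lemma infsum_sum_swap:
  fixes f :: "'a \<Rightarrow> 'b \<Rightarrow> 'c::{topological_comm_monoid_add, t2_space}"
  assumes "finite F" "\<And>x. x \<in> F \<Longrightarrow> f x summable_on L"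
  shows "(\<lambda>y. \<Sum>x\<in>F. f x y) summable_on L"
    and "(\<Sum>\<^sub>\<infinity>y\<in>L. \<Sum>x\<in>F. f x y) = (\<Sum>x\<in>F. infsum (f x) L)"
proof -
  have "((\<lambda>y. \<Sum>x\<in>F. f x y) has_sum (\<Sum>x\<in>F. infsum (f x) L)) L"
    using assms by (induction F rule: finite_induct) (auto intro: has_sum_add)
  then show "(\<lambda>y. \<Sum>x\<in>F. f x y) summable_on L"
    "(\<Sum>\<^sub>\<infinity>y\<in>L. \<Sum>x\<in>F. f x y) = (\<Sum>x\<in>F. infsum (f x) L)"
    by (auto simp: has_sum_iff)
qed

text \<open>Writing \<open>G\<close> as the product of two square roots, Cauchy-Schwarz bounds the
  square of a row of \<open>A\<close> applied to \<open>u\<close> by \<open>S\<close> times the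
  \<open>G\<close>-weighted sum of |u|^2. Summing over x and exchanging the sums brings in the
  column bound, hence the second factor \<open>S\<close>. Row and column sums are taken over finite
  sets, the form in which the lattice bounds below arrive.\<close>

lemma schur_test:
  fixes A :: "'a \<Rightarrow> 'a \<Rightarrow> complex" and G :: "'a \<Rightarrow> 'a \<Rightarrow> real" and u :: "'a \<Rightarrow> complex"
  assumes A: "\<And>x y. x \<in> L \<Longrightarrow> y \<in> L \<Longrightarrow> cmod (A x y) \<le> G x y"
    and rows: "\<And>x F. x \<in> L \<Longrightarrow> finite F \<Longrightarrow> F \<subseteq> L \<Longrightarrow> (\<Sum>y\<in>F. G x y) \<le> S"
    and cols: "\<And>y F. y \<in> L \<Longrightarrow> finite F \<Longrightarrow> F \<subseteq> L \<Longrightarrow> (\<Sum>x\<in>F. G x y) \<le> S"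
    and u: "(\<lambda>y. (cmod (u y))\<^sup>2) summable_on L"
  shows "\<And>x. x \<in> L \<Longrightarrow> (\<lambda>y. A x y * u y) summable_on L"
    and "(\<lambda>x. (cmod (\<Sum>\<^sub>\<infinity>y\<in>L. A x y * u y))\<^sup>2) summable_on L"
    and "(\<Sum>\<^sub>\<infinity>x\<in>L. (cmod (\<Sum>\<^sub>\<infinity>y\<in>L. A x y * u y))\<^sup>2) \<le> S\<^sup>2 * (\<Sum>\<^sub>\<infinity>y\<in>L. (cmod (u y))\<^sup>2)"
proof -
  define U where "U = (\<Sum>\<^sub>\<infinity>y\<in>L. (cmod (u y))\<^sup>2)"
  have G0: "0 \<le> G x y" if "x \<in> L" "y \<in> L" for x y
    using A[OF that] norm_ge_zero order_trans by blast
  have S0: "0 \<le> S" if "x \<in> L" for x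
    using rows[OF that, of "{}"] by simp
  have GS: "G x y \<le> S" if "x \<in> L" "y \<in> L" for x y
    using rows[of x "{y}"] that by simp
  \<comment> \<open>A one-point row sum bounds each entry of \<open>G\<close> by \<open>S\<close>,
    so this series is dominated by S |u|^2.\<close>
  have Gu: "(\<lambda>y. G x y * (cmod (u y))\<^sup>2) summable_on L" if x: "x \<in> L" for x
    by (rule summable_on_comparison_test[OF summable_on_cmult_right[OF u, of S]])
       (auto intro!: mult_right_mono mult_nonneg_nonneg GS x G0)
  have fin: "(\<Sum>y\<in>F. cmod (A x y * u y))\<^sup>2 \<le> S * (\<Sum>\<^sub>\<infinity>y\<in>L. G x y * (cmod (u y))\<^sup>2)"
    if x: "x \<in> L" and F: "finite F" "F \<subseteq> L" for x F
  proof -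
    have "(\<Sum>y\<in>F. cmod (A x y * u y)) \<le> (\<Sum>y\<in>F. sqrt (G x y) * (sqrt (G x y) * cmod (u y)))"
    proof (rule sum_mono)
      fix y assume "y \<in> F"
      then have y: "y \<in> L" using F by auto
      show "cmod (A x y * u y) \<le> sqrt (G x y) * (sqrt (G x y) * cmod (u y))"
        using mult_right_mono[OF A[OF x y], of "cmod (u y)"] G0[OF x y]
        by (simp add: norm_mult flip: mult.assoc)
    qed
    then have "(\<Sum>y\<in>F. cmod (A x y * u y))\<^sup>2 \<le> (\<Sum>y\<in>F. sqrt (G x y) * (sqrt (G x y) * cmod (u y)))\<^sup>2"
      by (intro power_mono sum_nonneg) auto
    also have "\<dots> \<le> (\<Sum>y\<in>F. (sqrt (G x y))\<^sup>2) * (\<Sum>y\<in>F. (sqrt (G x y) * cmod (u y))\<^sup>2)"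
      by (rule Cauchy_Schwarz_ineq_sum)
    also have "\<dots> = (\<Sum>y\<in>F. G x y) * (\<Sum>y\<in>F. G x y * (cmod (u y))\<^sup>2)"
      using F G0[OF x] by (intro arg_cong2[where f="(*)"] sum.cong) (auto simp: power_mult_distrib)
    also have "\<dots> \<le> S * (\<Sum>\<^sub>\<infinity>y\<in>L. G x y * (cmod (u y))\<^sup>2)"
      using F G0[OF x] x
      by (intro mult_mono rows finite_sum_le_infsum Gu) (auto intro!: sum_nonneg S0)
    finally show ?thesis .
  qed
  have bdd: "(\<Sum>y\<in>F. cmod (A x y * u y)) \<le> sqrt (S * (\<Sum>\<^sub>\<infinity>y\<in>L. G x y * (cmod (u y))\<^sup>2))"
    if x: "x \<in> L" and F: "finite F" "F \<subseteq> L" for x F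
    using fin[OF that] by (rule real_le_rsqrt)
  have abs: "(\<lambda>y. cmod (A x y * u y)) summable_on L" if x: "x \<in> L" for x
    by (rule nonneg_bdd_above_summable_on) (auto intro!: bdd_aboveI2 bdd x)
  show summ: "(\<lambda>y. A x y * u y) summable_on L" if x: "x \<in> L" for x
    using abs[OF x] by (rule abs_summable_summable)
  have pt: "(cmod (\<Sum>\<^sub>\<infinity>y\<in>L. A x y * u y))\<^sup>2 \<le> S * (\<Sum>\<^sub>\<infinity>y\<in>L. G x y * (cmod (u y))\<^sup>2)"
    if x: "x \<in> L" for x
  proof -
    have "cmod (\<Sum>\<^sub>\<infinity>y\<in>L. A x y * u y) \<le> (\<Sum>\<^sub>\<infinity>y\<in>L. cmod (A x y * u y))"
      by (rule norm_infsum_bound) (rule abs[OF x])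
    also have "\<dots> \<le> sqrt (S * (\<Sum>\<^sub>\<infinity>y\<in>L. G x y * (cmod (u y))\<^sup>2))"
      by (rule infsum_le_finite_sums[OF abs[OF x]]) (rule bdd[OF x])
    finally have "(cmod (\<Sum>\<^sub>\<infinity>y\<in>L. A x y * u y))\<^sup>2 \<le> (sqrt (S * (\<Sum>\<^sub>\<infinity>y\<in>L. G x y * (cmod (u y))\<^sup>2)))\<^sup>2"
      by (rule power_mono) simp
    also have "\<dots> = S * (\<Sum>\<^sub>\<infinity>y\<in>L. G x y * (cmod (u y))\<^sup>2)"
      using x S0[OF x] G0[OF x] by (simp add: infsum_nonneg)
    finally show ?thesis .
  qed
  have main: "(\<Sum>x\<in>F. (cmod (\<Sum>\<^sub>\<infinity>y\<in>L. A x y * u y))\<^sup>2) \<le> S\<^sup>2 * U"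
    if F: "finite F" "F \<subseteq> L" for F
  proof (cases "L = {}")
    case True
    with F show ?thesis by (auto simp: U_def infsum_nonneg)
  next
    case False
    \<comment> \<open>Nonnegativity of \<open>S\<close> comes from an empty row sum, which takes a
      point of \<open>L\<close> to index the row; hence the case split.\<close>
    then have S: "0 \<le> S" using S0 by blast
    have "(\<Sum>x\<in>F. (cmod (\<Sum>\<^sub>\<infinity>y\<in>L. A x y * u y))\<^sup>2) \<le> (\<Sum>x\<in>F. S * (\<Sum>\<^sub>\<infinity>y\<in>L. G x y * (cmod (u y))\<^sup>2))"
      using F by (intro sum_mono pt) auto
    also have "\<dots> = S * (\<Sum>x\<in>F. \<Sum>\<^sub>\<infinity>y\<in>L. G x y * (cmod (u y))\<^sup>2)"
      by (simp add: sum_distrib_left)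
    \<comment> \<open>The outer sum is finite, so the exchange only needs convergence of each row
      series; afterwards \<open>cols\<close> applies for every fixed y.\<close>
    also have "(\<Sum>x\<in>F. \<Sum>\<^sub>\<infinity>y\<in>L. G x y * (cmod (u y))\<^sup>2) = (\<Sum>\<^sub>\<infinity>y\<in>L. \<Sum>x\<in>F. G x y * (cmod (u y))\<^sup>2)"
      using F by (intro infsum_sum_swap(2)[symmetric] Gu) auto
    also have "\<dots> \<le> (\<Sum>\<^sub>\<infinity>y\<in>L. S * (cmod (u y))\<^sup>2)"
    proof (rule infsum_mono)
      show "(\<lambda>y. \<Sum>x\<in>F. G x y * (cmod (u y))\<^sup>2) summable_on L"
        using F by (intro infsum_sum_swap(1) Gu) auto
      show "(\<lambda>y. S * (cmod (u y))\<^sup>2) summable_on L"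
        by (intro summable_on_cmult_right u)
      show "(\<Sum>x\<in>F. G x y * (cmod (u y))\<^sup>2) \<le> S * (cmod (u y))\<^sup>2" if "y \<in> L" for y
        using cols[OF that F] by (simp add: mult_right_mono flip: sum_distrib_right)
    qed
    also have "\<dots> = S * U" unfolding U_def by (simp add: infsum_cmult_right')
    finally show ?thesis using S by (simp add: power2_eq_square mult.assoc mult_left_mono)
  qed
  show sq: "(\<lambda>x. (cmod (\<Sum>\<^sub>\<infinity>y\<in>L. A x y * u y))\<^sup>2) summable_on L"
    by (rule nonneg_bdd_above_summable_on) (auto intro!: bdd_aboveI2 main)
  show "(\<Sum>\<^sub>\<infinity>x\<in>L. (cmod (\<Sum>\<^sub>\<infinity>y\<in>L. A x y * u y))\<^sup>2) \<le> S\<^sup>2 * (\<Sum>\<^sub>\<infinity>y\<in>L. (cmod (u y))\<^sup>2)"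
    using infsum_le_finite_sums[OF sq main] unfolding U_def .
qed

text \<open>The absolute value is injective on the nonnegative and on the negative members of
  \<open>A\<close>, so each half is a partial sum of the convergent series of 1/(1+n)^2. Integers
  are taken as reals because they will be coordinates of lattice vectors.\<close>

lemma sum_inverse_square_Ints_bounded:
  "\<exists>S. \<forall>A. finite A \<longrightarrow> A \<subseteq> \<int> \<longrightarrow> (\<Sum>x\<in>A. 1 / (1 + \<bar>x::real\<bar>)\<^sup>2) \<le> S"
proof -
  define q :: "nat \<Rightarrow> real" where "q n = 1 / (1 + real n)\<^sup>2" for n
  have "summable (\<lambda>n. inverse (real (Suc n) ^ 2))"
    using inverse_power_summable[of 2, where 'a=real] by (subst summable_Suc_iff) auto
  then have q: "summable q" by (simp add: q_def[abs_def] inverse_eq_divide add.commute)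
  have half: "(\<Sum>x\<in>A. 1 / (1 + \<bar>x\<bar>)\<^sup>2) \<le> suminf q"
    if A: "finite A" "A \<subseteq> \<int>" and inj: "inj_on abs A" for A :: "real set"
  proof -
    have eq: "real (nat \<lfloor>\<bar>x\<bar>\<rfloor>) = \<bar>x\<bar>" if "x \<in> A" for x
      proof -
      have "x \<in> \<int>" using that A by blast
      then obtain n where "x = of_int n" by (rule Ints_cases)
      then have "\<bar>x\<bar> = of_int \<bar>n\<bar>" by simp
      then show ?thesis by (simp del: of_int_abs)
    qed
    have "inj_on (\<lambda>x. nat \<lfloor>\<bar>x\<bar>\<rfloor>) A"
    proof (rule inj_onI)
      fix x y assume "x \<in> A" "y \<in> A" "nat \<lfloor>\<bar>x\<bar>\<rfloor> = nat \<lfloor>\<bar>y\<bar>\<rfloor>"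
      then have "\<bar>x\<bar> = \<bar>y\<bar>" using eq by metis
      then show "x = y" using inj \<open>x \<in> A\<close> \<open>y \<in> A\<close> by (auto dest: inj_onD)
    qed
    then have "(\<Sum>n\<in>(\<lambda>x. nat \<lfloor>\<bar>x\<bar>\<rfloor>) ` A. q n) = (\<Sum>x\<in>A. q (nat \<lfloor>\<bar>x\<bar>\<rfloor>))"
      by (simp add: sum.reindex)
    also have "\<dots> = (\<Sum>x\<in>A. 1 / (1 + \<bar>x\<bar>)\<^sup>2)"
      by (intro sum.cong) (simp_all only: q_def eq)
    finally have "(\<Sum>n\<in>(\<lambda>x. nat \<lfloor>\<bar>x\<bar>\<rfloor>) ` A. q n) = (\<Sum>x\<in>A. 1 / (1 + \<bar>x\<bar>)\<^sup>2)" .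
    moreover have "(\<Sum>n\<in>(\<lambda>x. nat \<lfloor>\<bar>x\<bar>\<rfloor>) ` A. q n) \<le> suminf q"
      by (rule sum_le_suminf[OF q]) (use A in \<open>auto simp: q_def\<close>)
    ultimately show ?thesis by simp
  qed
  have "(\<Sum>x\<in>A. 1 / (1 + \<bar>x\<bar>)\<^sup>2) \<le> suminf q + suminf q" if A: "finite A" "A \<subseteq> \<int>" for A :: "real set"
  proof -
    have "(\<Sum>x\<in>A. 1 / (1 + \<bar>x\<bar>)\<^sup>2) =
        (\<Sum>x\<in>A \<inter> {0..}. 1 / (1 + \<bar>x\<bar>)\<^sup>2) + (\<Sum>x\<in>A - {0..}. 1 / (1 + \<bar>x\<bar>)\<^sup>2)"
      using A by (intro sum.Int_Diff)
    also have "\<dots> \<le> suminf q + suminf q"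
      using A by (intro add_mono half) (auto simp: inj_on_def)
    finally show ?thesis .
  qed
  then show ?thesis by blast
qed

text \<open>Each |p_i| is at most the norm of p, so an exponent of 2 per coordinate lets the summand
  be dominated by the product of the 1/(1+|p_i|)^2. Over a finite grid containing \<open>F\<close>
  the sum of such products factors into one-dimensional sums.\<close>

lemma sum_int_lattice_bounded:
  "\<exists>S. \<forall>F. finite F \<longrightarrow> F \<subseteq> int_lattice \<longrightarrow>
     (\<Sum>p\<in>F. 1 / (1 + norm (p :: real ^ 'n::finite)) ^ (2 * CARD('n))) \<le> S"
proof -
  obtain S where S: "\<And>A. finite A \<Longrightarrow> A \<subseteq> \<int> \<Longrightarrow> (\<Sum>x\<in>A. 1 / (1 + \<bar>x::real\<bar>)\<^sup>2) \<le> S"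
    using sum_inverse_square_Ints_bounded by blast
  have "(\<Sum>p\<in>F. 1 / (1 + norm p) ^ (2 * CARD('n))) \<le> S ^ CARD('n)"
    if F: "finite F" "F \<subseteq> int_lattice" for F :: "(real ^ 'n) set"
  proof -
    \<comment> \<open>\<open>A\<close> collects all coordinates occurring in \<open>F\<close>, so
      that \<open>F\<close>, read as a set of functions of the index, lies in the grid
      \<open>Pi\<^sub>E UNIV (\<lambda>_. A)\<close>.\<close>
    define A where "A = (\<Union>p\<in>F. range (($) p))"
    have A: "finite A" "A \<subseteq> \<int>" using F by (auto simp: A_def int_lattice_def)
    have "(\<Sum>p\<in>F. 1 / (1 + norm p) ^ (2 * CARD('n))) \<le> (\<Sum>p\<in>F. \<Prod>i\<in>UNIV. 1 / (1 + \<bar>p $ i\<bar>)\<^sup>2)"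
    proof (rule sum_mono)
      fix p :: "real ^ 'n"
      have "1 / (1 + norm p) ^ (2 * CARD('n)) = (\<Prod>i\<in>(UNIV::'n set). 1 / (1 + norm p)\<^sup>2)"
        by (simp add: power_mult power_one_over)
      also have "\<dots> \<le> (\<Prod>i\<in>UNIV. 1 / (1 + \<bar>p $ i\<bar>)\<^sup>2)"
        by (intro prod_mono conjI divide_left_mono power_mono add_mono)
           (auto simp: component_le_norm_cart intro!: mult_pos_pos zero_less_power add_pos_nonneg)
      finally show "1 / (1 + norm p) ^ (2 * CARD('n)) \<le> (\<Prod>i\<in>UNIV. 1 / (1 + \<bar>p $ i\<bar>)\<^sup>2)" .
    qed
    also have "\<dots> = (\<Sum>\<phi>\<in>($) ` F. \<Prod>i\<in>UNIV. 1 / (1 + \<bar>\<phi> i\<bar>)\<^sup>2)"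
      by (subst sum.reindex) (auto simp: inj_on_def vec_eq_iff)
    also have "\<dots> \<le> (\<Sum>\<phi>\<in>Pi\<^sub>E (UNIV :: 'n set) (\<lambda>_. A). \<Prod>i\<in>UNIV. 1 / (1 + \<bar>\<phi> i\<bar>)\<^sup>2)"
    proof (rule sum_mono2)
      show "finite (Pi\<^sub>E (UNIV :: 'n set) (\<lambda>_. A))" using A by (intro finite_PiE) auto
      show "($) ` F \<subseteq> Pi\<^sub>E UNIV (\<lambda>_. A)" by (auto simp: A_def)
    qed (auto intro!: prod_nonneg)
    also have "\<dots> = (\<Prod>i\<in>(UNIV::'n set). \<Sum>x\<in>A. 1 / (1 + \<bar>x\<bar>)\<^sup>2)"
      using A by (intro prod_sum_PiE[symmetric]) auto
    also have "\<dots> \<le> S ^ CARD('n)"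
      using S[OF A] by (auto intro!: power_mono sum_nonneg)
    finally show ?thesis .
  qed
  then show ?thesis by blast
qed

text \<open>For nonnegative exponents this is a power of the triangle inequality. For negative ones,
  exchange x and y in that case and take reciprocals.\<close>

lemma Peetre_powr:
  fixes x y :: "'a::real_normed_vector"
  shows "(1 + norm x) powr s \<le> (1 + norm y) powr s * (1 + norm (x - y)) powr \<bar>s\<bar>"
proof -
  have *: "(1 + norm a) powr t \<le> (1 + norm b) powr t * (1 + norm (a - b)) powr t"
    if "0 \<le> t" for a b :: 'a and t
  proof -
    have "1 + norm a \<le> (1 + norm b) * (1 + norm (a - b))"
      using norm_triangle_sub[of a b] mult_nonneg_nonneg[OF norm_ge_zero[of b] norm_ge_zero[of "a - b"]]
      by (simp only: distrib_left distrib_right)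
    then have "(1 + norm a) powr t \<le> ((1 + norm b) * (1 + norm (a - b))) powr t"
      using that by (intro powr_mono2) auto
    then show ?thesis by (simp add: powr_mult)
  qed
  show ?thesis
  proof (cases "0 \<le> s")
    case True
    then show ?thesis using *[of s x y] by simp
  next
    case False
    have pos: "0 < 1 + norm z" for z :: 'a by (rule add_pos_nonneg) auto
    have "(1 + norm x) powr s = 1 / (1 + norm x) powr - s"
      by (simp add: powr_minus_divide)
    also have "\<dots> \<le> (1 + norm (x - y)) powr - s / (1 + norm y) powr - s"
      using *[of "- s" y x] False pos[of x] pos[of y]
      by (simp add: norm_minus_commute divide_simps mult_ac)
    finally show ?thesis using False by (simp add: powr_minus_divide mult.commute)
  qed
qed

section \<open>Fourier coefficients and toroidal operators\<close>

text \<open>Cut the shifted cube by the hyperplane x_j = 1 and move the overhanging slab back by one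
  unit vector: the two pieces then tile the original cube.\<close>

lemma integral_periodic_shift:
  fixes g :: "real ^ 'n::finite \<Rightarrow> complex"
  assumes cont: "continuous_on UNIV g" and per: "torus_periodic g" and s: "0 \<le> s" "s \<le> 1"
  shows "integral (cbox 0 1) (\<lambda>\<theta>. g (\<theta> + s *\<^sub>R axis j 1)) = integral (cbox 0 1) g"
proof -
  define e where "e = (axis j 1 :: real ^ 'n)"
  have e: "e \<in> Basis" by (simp add: e_def axis_in_Basis_iff)
  have intg: "g integrable_on cbox a b" for a b
    by (intro integrable_continuous continuous_on_subset[OF cont]) auto
  have "e \<in> int_lattice" by (auto simp: e_def int_lattice_def axis_def)
  then have shift: "g \<circ> (+) e = g"
    using per by (auto simp: torus_periodic_def fun_eq_iff add.commute)
  have comp: "x \<bullet> e = x $ j" for x by (simp add: e_def inner_axis)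
  have ei: "e $ i = (if i = j then 1 else 0)" for i by (simp add: e_def axis_def)
  have box: "x \<in> cbox a b \<longleftrightarrow> (a $ j \<le> x $ j \<and> x $ j \<le> b $ j) \<and>
      (\<forall>i. i \<noteq> j \<longrightarrow> a $ i \<le> x $ i \<and> x $ i \<le> b $ i)" for x a b :: "real ^ 'n"
    by (auto simp: mem_box_cart)
  have "integral (cbox 0 1) (\<lambda>\<theta>. g (\<theta> + s *\<^sub>R e)) = integral (cbox (s *\<^sub>R e) (1 + s *\<^sub>R e)) g"
    using integral_shift_cbox_plus[of 0 1 g "s *\<^sub>R e"] by (simp add: o_def add.commute)
  also have "\<dots> = integral (cbox (s *\<^sub>R e) (1 + s *\<^sub>R e) \<inter> {x. x \<bullet> e \<le> 1}) g +
      integral (cbox (s *\<^sub>R e) (1 + s *\<^sub>R e) \<inter> {x. x \<bullet> e \<ge> 1}) g"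
    by (rule integral_split[OF intg e])
  also have "cbox (s *\<^sub>R e) (1 + s *\<^sub>R e) \<inter> {x. x \<bullet> e \<le> 1} = cbox 0 1 \<inter> {x. x \<bullet> e \<ge> s}"
    using s by (auto simp: box comp ei)
  \<comment> \<open>The corner \<open>1 - e + s *\<^sub>R e\<close> has j-th coordinate s and all
    others 1, so the overhang is the unit translate of the slab 0 \<le> x_j \<le> s.\<close>
  also have "cbox (s *\<^sub>R e) (1 + s *\<^sub>R e) \<inter> {x. x \<bullet> e \<ge> 1} = cbox (0 + e) ((1 - e + s *\<^sub>R e) + e)"
    using s by (auto simp: box comp ei)
  also have "integral \<dots> g = integral (cbox 0 (1 - e + s *\<^sub>R e)) g"
    using integral_shift_cbox_plus[of 0 "1 - e + s *\<^sub>R e" g e] shift by simp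
  also have "cbox 0 (1 - e + s *\<^sub>R e) = cbox 0 1 \<inter> {x. x \<bullet> e \<le> s}"
    using s by (auto simp: box comp ei)
  also have "integral (cbox 0 1 \<inter> {x. x \<bullet> e \<ge> s}) g + integral (cbox 0 1 \<inter> {x. x \<bullet> e \<le> s}) g
      = integral (cbox 0 1) g"
    using integral_split[OF intg e, of 0 1 s] by simp
  finally show ?thesis by (simp add: e_def)
qed

text \<open>
  By periodicity the derivative integrates to zero along each closed line in direction \<open>j\<close>;
  averaging these lines over the cube and swapping the integrals avoids splitting off a coordinate.
\<close>

lemma integral_periodic_partial_zero:
  fixes F F' :: "real ^ 'n::finite \<Rightarrow> complex"
  assumes F: "torus_periodic F"
    and F': "continuous_on UNIV F'" "torus_periodic F'"
    and deriv: "\<And>\<theta>. ((\<lambda>t. F (\<theta> + t *\<^sub>R axis j 1)) has_vector_derivative F' \<theta>) (at 0)"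
  shows "integral (cbox 0 1) F' = 0"
proof -
  define e where "e = (axis j 1 :: real ^ 'n)"
  have lat: "e \<in> int_lattice" by (auto simp: e_def int_lattice_def axis_def)
  have cont2: "continuous_on A (\<lambda>(\<theta>, s). F' (\<theta> + s *\<^sub>R e))" for A
    unfolding case_prod_unfold
    by (intro continuous_on_compose2[OF F'(1)] continuous_intros) auto
  have zero: "integral (cbox 0 1) (\<lambda>s. F' (\<theta> + s *\<^sub>R e)) = 0" for \<theta>
  proof -
    have "((\<lambda>t. F (\<theta> + t *\<^sub>R e)) has_vector_derivative F' (\<theta> + s *\<^sub>R e)) (at s within {0..1})" for s
    proof -
      \<comment> \<open>The assumption \<open>deriv\<close> speaks of time 0 only, but at every base
        point; moving the base point to time s gives the derivative there.\<close>
      have "((\<lambda>t. F ((\<theta> + s *\<^sub>R e) + t *\<^sub>R e)) has_vector_derivative F' (\<theta> + s *\<^sub>R e)) (at (s - s))"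
        using deriv[of "\<theta> + s *\<^sub>R e"] by (simp add: e_def)
      then have "((\<lambda>t. F ((\<theta> + s *\<^sub>R e) + t *\<^sub>R e)) \<circ> (\<lambda>t. t - s) has_vector_derivative 1 *\<^sub>R F' (\<theta> + s *\<^sub>R e)) (at s)"
        by (intro vector_diff_chain_at) (auto intro!: derivative_eq_intros)
      moreover have "(\<lambda>t. F ((\<theta> + s *\<^sub>R e) + t *\<^sub>R e)) \<circ> (\<lambda>t. t - s) = (\<lambda>t. F (\<theta> + t *\<^sub>R e))"
        by (auto simp: fun_eq_iff algebra_simps)
      ultimately show ?thesis by (simp add: has_vector_derivative_at_within)
    qed
    then have "((\<lambda>s. F' (\<theta> + s *\<^sub>R e)) has_integral F (\<theta> + 1 *\<^sub>R e) - F (\<theta> + 0 *\<^sub>R e)) {0..1}"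
      by (intro fundamental_theorem_of_calculus) auto
    moreover have "F (\<theta> + e) = F \<theta>" using F lat by (auto simp: torus_periodic_def)
    ultimately show ?thesis by (simp add: integral_unique)
  qed
  have "0 = integral (cbox 0 1) (\<lambda>\<theta>. integral (cbox 0 1) (\<lambda>s. F' (\<theta> + s *\<^sub>R e)))"
    by (simp only: zero) simp
  also have "\<dots> = integral (cbox 0 1) (\<lambda>s. integral (cbox 0 1) (\<lambda>\<theta>. F' (\<theta> + s *\<^sub>R e)))"
    by (rule integral_swap_continuous[OF cont2])
  also have "\<dots> = integral (cbox 0 (1::real)) (\<lambda>s. integral (cbox 0 1) F')"
    by (rule integral_cong) (auto simp: e_def intro!: integral_periodic_shift F')
  also have "\<dots> = integral (cbox 0 1) F'" by simp
  finally show ?thesis by simp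
qed

text \<open>The exponent is positive, to match \<open>op_kernel\<close> with p = (k - m)/h; in the
  usual convention this is the coefficient at frequency -p.\<close>

definition fourier_coeff :: "(real ^ 'n::finite \<Rightarrow> complex) \<Rightarrow> real ^ 'n \<Rightarrow> complex" where
  "fourier_coeff g p = integral (cbox 0 1) (\<lambda>\<theta>. cis (2 * pi * (p \<bullet> \<theta>)) * g \<theta>)"

section \<open>Smooth and periodic functions under partial derivatives and toroidal factors\<close>

lemma smooth_fun_continuous: "smooth_fun g \<Longrightarrow> continuous_on UNIV g"
  unfolding smooth_fun_def by (metis foldr.simps(1) id_apply)

lemma smooth_fun_has_partials: "smooth_fun g \<Longrightarrow> has_partials g"
  unfolding smooth_fun_def by (metis foldr.simps(1) id_apply)

lemma smooth_fun_partial_deriv: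
  assumes "smooth_fun g" shows "smooth_fun (partial_deriv j g)"
proof -
  have "foldr partial_deriv js (partial_deriv j g) = foldr partial_deriv (js @ [j]) g" for js
    by simp
  then show ?thesis using assms unfolding smooth_fun_def by presburger
qed

lemma has_partials_vector_derivative:
  "has_partials g \<Longrightarrow>
     ((\<lambda>t. g (\<theta> + t *\<^sub>R axis j 1)) has_vector_derivative partial_deriv j g \<theta>) (at 0)"
  by (simp add: has_partials_def partial_deriv_def flip: vector_derivative_works)

lemma partial_deriv_lincomb:
  assumes "has_partials f" "has_partials g"
  shows "has_partials (\<lambda>\<theta>. a * f \<theta> + b * g \<theta>)"
    and "partial_deriv j (\<lambda>\<theta>. a * f \<theta> + b * g \<theta>) = (\<lambda>\<theta>. a * partial_deriv j f \<theta> + b * partial_deriv j g \<theta>)"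
proof -
  have *: "((\<lambda>t. a * f (\<theta> + t *\<^sub>R axis i 1) + b * g (\<theta> + t *\<^sub>R axis i 1))
      has_vector_derivative a * partial_deriv i f \<theta> + b * partial_deriv i g \<theta>) (at 0)" for \<theta> i
    by (intro has_vector_derivative_add has_vector_derivative_mult_right
        has_partials_vector_derivative assms)
  show "has_partials (\<lambda>\<theta>. a * f \<theta> + b * g \<theta>)"
    unfolding has_partials_def using * by (blast intro: differentiableI_vector)
  show "partial_deriv j (\<lambda>\<theta>. a * f \<theta> + b * g \<theta>) = (\<lambda>\<theta>. a * partial_deriv j f \<theta> + b * partial_deriv j g \<theta>)"
    using vector_derivative_at[OF *] by (auto simp: partial_deriv_def fun_eq_iff)
qed

text \<open>Serves the toroidal factors, each of which is a linear combination of a partial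
  derivative and the identity.\<close>

lemma smooth_fun_lincomb:
  assumes f: "smooth_fun f" and g: "smooth_fun g"
  shows "smooth_fun (\<lambda>\<theta>. a * f \<theta> + b * g \<theta>)"
proof -
  have "foldr partial_deriv js (\<lambda>\<theta>. a * f \<theta> + b * g \<theta>) =
      (\<lambda>\<theta>. a * foldr partial_deriv js f \<theta> + b * foldr partial_deriv js g \<theta>)" for js
  proof (induction js)
    case (Cons j js)
    have "has_partials (foldr partial_deriv js f)" "has_partials (foldr partial_deriv js g)"
      using f g by (auto simp: smooth_fun_def)
    then show ?case using Cons by (simp add: partial_deriv_lincomb(2))
  qed simp
  then show ?thesis
    using f g by (simp add: smooth_fun_def partial_deriv_lincomb(1) continuous_on_add continuous_on_mult_left)
qed

lemma torus_periodic_partial_deriv: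
  assumes "torus_periodic g" shows "torus_periodic (partial_deriv j g)"
proof -
  have "g (\<theta> + z + t *\<^sub>R axis j 1) = g (\<theta> + t *\<^sub>R axis j 1)" if "z \<in> int_lattice" for \<theta> z t
  proof -
    have "g ((\<theta> + t *\<^sub>R axis j 1) + z) = g (\<theta> + t *\<^sub>R axis j 1)"
      using assms that unfolding torus_periodic_def by blast
    then show ?thesis by (simp add: add_ac)
  qed
  then show ?thesis by (simp add: torus_periodic_def partial_deriv_def)
qed

lemma toroidal_factor_lincomb:
  "toroidal_factor j l g = (\<lambda>\<theta>. 1 / (2 * of_real pi * \<i>) * partial_deriv j g \<theta> + (- of_nat l) * g \<theta>)"
  by (auto simp: toroidal_factor_def fun_eq_iff)

lemma smooth_fun_toroidal_factor: "smooth_fun g \<Longrightarrow> smooth_fun (toroidal_factor j l g)"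
  unfolding toroidal_factor_lincomb by (intro smooth_fun_lincomb smooth_fun_partial_deriv)

lemma torus_periodic_toroidal_factor:
  "torus_periodic g \<Longrightarrow> torus_periodic (toroidal_factor j l g)"
  using torus_periodic_partial_deriv[of g j] by (simp add: torus_periodic_def toroidal_factor_def)

lemma int_lattice_inner_Ints: "p \<in> int_lattice \<Longrightarrow> z \<in> int_lattice \<Longrightarrow> p \<bullet> z \<in> \<int>"
  by (auto simp: int_lattice_def inner_vec_def)

text \<open>The point where integrality of the frequency enters: p . z is an integer for lattice z,
  so the exponential does not see the shift.\<close>

lemma torus_periodic_mode:
  assumes "p \<in> int_lattice" "torus_periodic g"
  shows "torus_periodic (\<lambda>\<theta>. cis (2 * pi * (p \<bullet> \<theta>)) * g \<theta>)"
  using assms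
  by (auto simp: torus_periodic_def inner_add_right distrib_left int_lattice_inner_Ints simp flip: cis_mult)

lemma integrable_mode:
  fixes g :: "real ^ 'n::finite \<Rightarrow> complex"
  assumes "continuous_on UNIV g"
  shows "(\<lambda>\<theta>. cis (2 * pi * (p \<bullet> \<theta>)) * g \<theta>) integrable_on cbox a b"
  by (intro integrable_continuous continuous_intros continuous_on_subset[OF assms]) auto

text \<open>Integration by parts on the torus: \<open>F'\<close> is the j-th derivative of the
  periodic product \<open>E\<close> times \<open>g\<close>, so its integral vanishes, and the
  product rule splits it into the two coefficients.\<close>

lemma fourier_coeff_partial_deriv:
  assumes g: "smooth_fun g" "torus_periodic g" and p: "p \<in> int_lattice"
  shows "fourier_coeff (partial_deriv j g) p = - (2 * of_real pi * \<i> * of_real (p $ j)) * fourier_coeff g p"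
proof -
  define E where "E \<theta> = cis (2 * pi * (p \<bullet> \<theta>))" for \<theta>
  define c where "c = 2 * of_real pi * \<i> * complex_of_real (p $ j)"
  define F' where "F' \<theta> = E \<theta> * partial_deriv j g \<theta> + c * (E \<theta> * g \<theta>)" for \<theta>
  have cont: "continuous_on UNIV g" "continuous_on UNIV (partial_deriv j g)"
    using g by (auto intro: smooth_fun_continuous smooth_fun_partial_deriv)
  have "integral (cbox 0 1) F' = 0"
  proof (rule integral_periodic_partial_zero)
    show "torus_periodic (\<lambda>\<theta>. E \<theta> * g \<theta>)"
      unfolding E_def by (intro torus_periodic_mode p g)
    show "continuous_on UNIV F'"
      unfolding F'_def E_def by (intro continuous_intros cont)
    show "torus_periodic F'"
      using torus_periodic_mode[OF p g(2)] torus_periodic_mode[OF p torus_periodic_partial_deriv[OF g(2), of j]]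
      unfolding torus_periodic_def F'_def E_def by metis
    fix \<theta>
    have "((\<lambda>t. E (\<theta> + t *\<^sub>R axis j 1)) has_vector_derivative c * E \<theta>) (at 0)"
    proof -
      have eq: "E (\<theta> + t *\<^sub>R axis j 1) = E \<theta> * exp (c * of_real t)" for t
        by (simp add: E_def c_def inner_add_right inner_axis distrib_left cis_conv_exp exp_add mult_ac)
      have "((\<lambda>t. E \<theta> * exp (c * of_real t)) has_vector_derivative E \<theta> * c) (at 0)"
        by (intro has_vector_derivative_mult_right has_vector_derivative_real_field)
           (auto intro!: derivative_eq_intros)
      then show ?thesis by (simp add: eq mult.commute)
    qed
    from has_vector_derivative_mult[OF this has_partials_vector_derivative[OF smooth_fun_has_partials[OF g(1)], of \<theta> j]]
    show "((\<lambda>t. E (\<theta> + t *\<^sub>R axis j 1) * g (\<theta> + t *\<^sub>R axis j 1)) has_vector_derivative F' \<theta>) (at 0)"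
      by (simp add: F'_def mult.assoc)
  qed
  moreover have "integral (cbox 0 1) F' = fourier_coeff (partial_deriv j g) p + c * fourier_coeff g p"
    unfolding F'_def fourier_coeff_def E_def
    by (subst integral_add) (auto intro!: integrable_mode cont integrable_on_mult_right)
  ultimately show ?thesis by (simp add: c_def add_eq_0_iff2)
qed

lemma fourier_coeff_toroidal_factor:
  assumes g: "smooth_fun g" "torus_periodic g" and p: "p \<in> int_lattice"
  shows "fourier_coeff (toroidal_factor j l g) p = - of_real (p $ j + real l) * fourier_coeff g p"
proof -
  have cont: "continuous_on UNIV g" "continuous_on UNIV (partial_deriv j g)"
    using g by (auto intro: smooth_fun_continuous smooth_fun_partial_deriv)
  have "fourier_coeff (toroidal_factor j l g) p = integral (cbox 0 1)
      (\<lambda>\<theta>. 1 / (2 * of_real pi * \<i>) * (cis (2 * pi * (p \<bullet> \<theta>)) * partial_deriv j g \<theta>) +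
        (- of_nat l) * (cis (2 * pi * (p \<bullet> \<theta>)) * g \<theta>))"
    by (simp only: fourier_coeff_def toroidal_factor_lincomb algebra_simps)
  also have "\<dots> = 1 / (2 * of_real pi * \<i>) * fourier_coeff (partial_deriv j g) p - of_nat l * fourier_coeff g p"
    unfolding fourier_coeff_def
    by (subst integral_add) (auto intro!: integrable_mode cont integrable_on_mult_right integrable_neg)
  also have "\<dots> = - of_real (p $ j + real l) * fourier_coeff g p"
    by (simp add: fourier_coeff_partial_deriv[OF g p] algebra_simps)
  finally show ?thesis .
qed

text \<open>The three claims go through one induction because the formula for the next factor
  requires the previous iterate to be smooth and periodic.\<close>

lemma toroidal_factors_iterate:
  assumes g: "smooth_fun g" "torus_periodic g" and p: "p \<in> int_lattice"
  shows "smooth_fun (foldr (toroidal_factor j) ls g)"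
    and "torus_periodic (foldr (toroidal_factor j) ls g)"
    and "fourier_coeff (foldr (toroidal_factor j) ls g) p =
      (\<Prod>l\<leftarrow>ls. - of_real (p $ j + real l)) * fourier_coeff g p"
  by (induction ls)
     (simp_all add: g smooth_fun_toroidal_factor torus_periodic_toroidal_factor
       fourier_coeff_toroidal_factor p mult.assoc)

lemma fourier_coeff_bound:
  fixes g :: "real ^ 'n::finite \<Rightarrow> complex"
  assumes g: "continuous_on UNIV g" and B: "\<And>\<theta>. cmod (g \<theta>) \<le> B"
  shows "cmod (fourier_coeff g p) \<le> B"
proof -
  have "cmod (fourier_coeff g p) \<le> integral (cbox 0 (1 :: real ^ 'n)) (\<lambda>_. B)"
    unfolding fourier_coeff_def
    by (intro integral_norm_bound_integral integrable_mode g) (auto simp: norm_mult B)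
  also have "\<dots> = B"
    by (simp add: content_cbox_cart interval_ne_empty_cart)
  finally show ?thesis .
qed

section \<open>Reducing the multi-index operators to a single coordinate\<close>

lemma coords_props: "distinct (coords :: 'n::finite list)" "set (coords :: 'n list) = UNIV"
proof -
  have "\<exists>js. distinct js \<and> set js = (UNIV :: 'n set)"
    using finite_distinct_list[of "UNIV :: 'n set"] by auto
  then have "distinct (coords :: 'n list) \<and> set (coords :: 'n list) = UNIV"
    unfolding coords_def by (rule someI_ex)
  then show "distinct (coords :: 'n::finite list)" "set (coords :: 'n list) = UNIV" by auto
qed

lemma diff_op_multi_zero: "diff_op_multi h (\<lambda>_. 0) g = g"
proof -
  have "foldr (\<lambda>j. diff_op h j ^^ 0) js g = g" for js
    by (induction js) auto
  then show ?thesis by (simp add: diff_op_multi_def)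
qed

text \<open>Zero exponents contribute identities, and since \<open>coords\<close> lists j exactly
  once, the factor block for j is applied exactly once.\<close>

lemma toroidal_op_single:
  "toroidal_op h (\<lambda>i. if i = j then N else 0) g \<theta> =
     of_real (h ^ N) * foldr (toroidal_factor j) [0..<N] g \<theta>"
proof -
  define D where "D = (\<lambda>i. foldr (toroidal_factor i) [0..<(if i = j then N else 0)])"
  have triv: "foldr D js f = f" if "j \<notin> set js" for js f
    using that by (induction js) (auto simp: D_def)
  have "j \<in> set coords" by (simp add: coords_props)
  then obtain xs ys where split: "coords = xs @ j # ys"
    by (meson split_list)
  with coords_props(1) have "distinct (xs @ j # ys)" by simp
  then have notin: "j \<notin> set xs" "j \<notin> set ys" by auto
  have "foldr D coords g = foldr (toroidal_factor j) [0..<N] g"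
    by (simp add: split triv notin) (simp add: D_def)
  then show ?thesis by (simp add: toroidal_op_def D_def)
qed

section \<open>Kernel decay and boundedness\<close>

lemma op_kernel_eq_fourier_coeff:
  "op_kernel h \<sigma> k m = fourier_coeff (\<sigma> k) ((1 / h) *\<^sub>R (k - m))"
  by (simp add: op_kernel_def fourier_coeff_def cis_conv_exp mult_ac)

lemma norm_prod_list_ge:
  fixes f :: "'a \<Rightarrow> complex"
  assumes "\<And>l. l \<in> set ls \<Longrightarrow> c \<le> cmod (f l)" "0 \<le> c"
  shows "c ^ length ls \<le> cmod (\<Prod>l\<leftarrow>ls. f l)"
  using assms by (induction ls) (auto simp: norm_mult intro!: mult_mono)

lemma symbol_class_toroidal_bound:
  fixes \<sigma> :: "real ^ 'n::finite \<Rightarrow> real ^ 'n \<Rightarrow> complex"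
  assumes \<sigma>: "\<sigma> \<in> symbol_class h r" and h: "0 < h"
  obtains B where "0 \<le> B" and
    "\<And>k \<theta>. k \<in> hlattice h \<Longrightarrow>
      cmod (foldr (toroidal_factor j) [0..<N] (\<sigma> k) \<theta>) \<le> B * (1 + norm k) powr r"
proof -
  have "\<forall>\<alpha> \<beta>. \<exists>C. \<forall>k\<in>hlattice h. \<forall>\<theta>.
      cmod (toroidal_op h \<beta> (\<lambda>\<theta>'. diff_op_multi h \<alpha> (\<lambda>k'. \<sigma> k' \<theta>') k) \<theta>) \<le> C * (1 + norm k) powr r"
    using \<sigma> by (simp add: symbol_class_def)
  then obtain C where C: "\<forall>k\<in>hlattice h. \<forall>\<theta>.
      cmod (toroidal_op h (\<lambda>i. if i = j then N else 0)
        (\<lambda>\<theta>'. diff_op_multi h (\<lambda>_. 0) (\<lambda>k'. \<sigma> k' \<theta>') k) \<theta>) \<le> C * (1 + norm k) powr r"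
    by meson
  show thesis
  proof (rule that)
    \<comment> \<open>Dividing by \<open>h ^ N\<close> undoes the scaling in
      \<open>toroidal_op\<close>, so the constant depends on h; the absolute value makes it
      nonnegative.\<close>
    show "0 \<le> \<bar>C\<bar> / h ^ N" using h by simp
    fix k \<theta> :: "real ^ 'n" assume "k \<in> hlattice h"
    with C have "h ^ N * cmod (foldr (toroidal_factor j) [0..<N] (\<sigma> k) \<theta>) \<le> C * (1 + norm k) powr r"
      using h by (simp add: diff_op_multi_zero toroidal_op_single norm_mult norm_power)
    also have "\<dots> \<le> \<bar>C\<bar> * (1 + norm k) powr r" by (intro mult_right_mono) auto
    finally show "cmod (foldr (toroidal_factor j) [0..<N] (\<sigma> k) \<theta>) \<le> \<bar>C\<bar> / h ^ N * (1 + norm k) powr r"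
      using h by (simp add: field_simps)
  qed
qed

lemma fourier_coeff_decay_coordinate:
  fixes \<sigma> :: "real ^ 'n::finite \<Rightarrow> real ^ 'n \<Rightarrow> complex"
  assumes \<sigma>: "\<sigma> \<in> symbol_class h r" and h: "0 < h"
  shows "\<exists>C\<ge>0. \<forall>k\<in>hlattice h. \<forall>p\<in>int_lattice.
    (1 + \<bar>p $ j\<bar>) ^ N * cmod (fourier_coeff (\<sigma> k) p) \<le> C * (1 + norm k) powr r"
proof -
  obtain B0 where B0: "0 \<le> B0"
    "\<And>k \<theta>. k \<in> hlattice h \<Longrightarrow> cmod (foldr (toroidal_factor j) [0..<0] (\<sigma> k) \<theta>) \<le> B0 * (1 + norm k) powr r"
    using symbol_class_toroidal_bound[OF \<sigma> h] by blast
  obtain B where B: "0 \<le> B"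
    "\<And>k \<theta>. k \<in> hlattice h \<Longrightarrow> cmod (foldr (toroidal_factor j) [0..<N] (\<sigma> k) \<theta>) \<le> B * (1 + norm k) powr r"
    using symbol_class_toroidal_bound[OF \<sigma> h] by blast
  \<comment> \<open>The first summand of the constant serves large |p_j|, through the N toroidal
    factors; the second serves small |p_j|, through the bound \<open>B0\<close> on the symbol
    itself.\<close>
  have "(1 + \<bar>p $ j\<bar>) ^ N * cmod (fourier_coeff (\<sigma> k) p) \<le>
      (2 ^ N * B + (2 * real N + 2) ^ N * B0) * (1 + norm k) powr r"
    if k: "k \<in> hlattice h" and p: "p \<in> int_lattice" for k p
  proof -
    let ?w = "(1 + norm k) powr r"
    have g: "smooth_fun (\<sigma> k)" "torus_periodic (\<sigma> k)" using \<sigma> k by (auto simp: symbol_class_def)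
    note it = toroidal_factors_iterate[OF g p, of j "[0..<N]"]
    \<comment> \<open>The product of the factors \<open>p\<^sub>j + l\<close> vanishes at \<open>p\<^sub>j = -l\<close>, so small \<open>\<bar>p\<^sub>j\<bar>\<close> are treated
      with the plain bound on the symbol.\<close>
    show ?thesis
    proof (cases "\<bar>p $ j\<bar> \<ge> 2 * real N + 1")
      case True
      \<comment> \<open>Each |p_j + l| is at least |p_j| - N, which is at least (1 + |p_j|)/2 as
        soon as |p_j| reaches 2N + 1. The halves produce the factor \<open>2 ^ N\<close>.\<close>
      have "((1 + \<bar>p $ j\<bar>) / 2) ^ length [0..<N] \<le> cmod (\<Prod>l\<leftarrow>[0..<N]. - complex_of_real (p $ j + real l))"
      proof (rule norm_prod_list_ge)
        fix l assume "l \<in> set [0..<N]"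
        then have "real l \<le> real N" by simp
        moreover have "\<bar>p $ j\<bar> \<le> \<bar>p $ j + real l\<bar> + real l"
          using abs_triangle_ineq4[of "p $ j + real l" "real l"] by simp
        ultimately have "(1 + \<bar>p $ j\<bar>) / 2 \<le> \<bar>p $ j + real l\<bar>"
          using True by (simp add: field_simps)
        then show "(1 + \<bar>p $ j\<bar>) / 2 \<le> cmod (- complex_of_real (p $ j + real l))"
          by (simp only: norm_minus_cancel norm_of_real)
      qed simp
      then have "((1 + \<bar>p $ j\<bar>) / 2) ^ N * cmod (fourier_coeff (\<sigma> k) p) \<le>
          cmod (\<Prod>l\<leftarrow>[0..<N]. - complex_of_real (p $ j + real l)) * cmod (fourier_coeff (\<sigma> k) p)"
        by (intro mult_right_mono) auto
      also have "\<dots> = cmod (fourier_coeff (foldr (toroidal_factor j) [0..<N] (\<sigma> k)) p)"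
        by (simp only: it(3) norm_mult)
      also have "\<dots> \<le> B * ?w"
        by (rule fourier_coeff_bound[OF smooth_fun_continuous[OF it(1)] B(2)[OF k]])
      finally have "(1 + \<bar>p $ j\<bar>) ^ N * cmod (fourier_coeff (\<sigma> k) p) \<le> 2 ^ N * B * ?w"
        by (simp add: power_divide field_simps)
      moreover have "0 \<le> (2 * real N + 2) ^ N * B0 * ?w" using B0 by simp
      ultimately show ?thesis by (simp only: distrib_right)
    next
      case False
      have "cmod (fourier_coeff (\<sigma> k) p) \<le> B0 * ?w"
        using B0(2)[OF k] by (intro fourier_coeff_bound smooth_fun_continuous g) simp
      moreover have "(1 + \<bar>p $ j\<bar>) ^ N \<le> (2 * real N + 2) ^ N"
        using False by (intro power_mono) auto
      ultimately have "(1 + \<bar>p $ j\<bar>) ^ N * cmod (fourier_coeff (\<sigma> k) p) \<le> (2 * real N + 2) ^ N * (B0 * ?w)"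
        by (intro mult_mono) auto
      moreover have "0 \<le> 2 ^ N * B * ?w" using B by simp
      ultimately show ?thesis by (simp only: distrib_right mult.assoc)
    qed
  qed
  moreover have "0 \<le> 2 ^ N * B + (2 * real N + 2) ^ N * B0" using B B0 by simp
  ultimately show ?thesis by blast
qed

text \<open>Takes j to be a coordinate of largest modulus; it turns decay in single coordinates into
  decay in the norm.\<close>

lemma norm_le_card_max_component:
  fixes p :: "real ^ 'n::finite"
  obtains j where "1 + norm p \<le> real CARD('n) * (1 + \<bar>p $ j\<bar>)"
proof -
  obtain j where j: "\<And>i. \<bar>p $ i\<bar> \<le> \<bar>p $ j\<bar>"
  proof -
    have "Max (range (\<lambda>i. \<bar>p $ i\<bar>)) \<in> range (\<lambda>i. \<bar>p $ i\<bar>)" by (intro Max_in) auto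
    then obtain j where "Max (range (\<lambda>i. \<bar>p $ i\<bar>)) = \<bar>p $ j\<bar>" by blast
    then have "\<bar>p $ i\<bar> \<le> \<bar>p $ j\<bar>" for i by (metis Max_ge finite finite_imageI rangeI)
    then show thesis by (rule that)
  qed
  have "norm p \<le> (\<Sum>i\<in>UNIV. \<bar>p $ i\<bar>)" by (rule norm_le_l1_cart)
  also have "\<dots> \<le> real CARD('n) * \<bar>p $ j\<bar>" using j by (intro sum_bounded_above) auto
  finally have "norm p \<le> real CARD('n) * \<bar>p $ j\<bar>" .
  moreover have "1 \<le> real CARD('n)" by (simp add: Suc_le_eq)
  ultimately have "1 + norm p \<le> real CARD('n) * (1 + \<bar>p $ j\<bar>)" by (simp only: distrib_left mult_1_right add_mono)
  then show thesis by (rule that)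
qed

lemma fourier_coeff_decay:
  fixes \<sigma> :: "real ^ 'n::finite \<Rightarrow> real ^ 'n \<Rightarrow> complex"
  assumes \<sigma>: "\<sigma> \<in> symbol_class h r" and h: "0 < h"
  obtains C where "0 \<le> C" and "\<And>k p. k \<in> hlattice h \<Longrightarrow> p \<in> int_lattice \<Longrightarrow>
    (1 + norm p) ^ N * cmod (fourier_coeff (\<sigma> k) p) \<le> C * (1 + norm k) powr r"
proof -
  obtain C where C: "\<And>j. 0 \<le> C j" "\<And>j k p. k \<in> hlattice h \<Longrightarrow> p \<in> int_lattice \<Longrightarrow>
    (1 + \<bar>p $ j\<bar>) ^ N * cmod (fourier_coeff (\<sigma> k) p) \<le> C j * (1 + norm k) powr r"
    using fourier_coeff_decay_coordinate[OF \<sigma> h, of _ N] by metis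
  \<comment> \<open>The dominant coordinate j varies with p, so the constants of all coordinates are
    added to get one that serves every p.\<close>
  let ?D = "real CARD('n) ^ N * (\<Sum>j\<in>UNIV. C j)"
  show thesis
  proof (rule that[of ?D])
    show "0 \<le> ?D" using C(1) by (simp add: sum_nonneg)
    fix k p :: "real ^ 'n" assume k: "k \<in> hlattice h" and p: "p \<in> int_lattice"
    obtain j where j: "1 + norm p \<le> real CARD('n) * (1 + \<bar>p $ j\<bar>)"
      by (rule norm_le_card_max_component)
    have "(1 + norm p) ^ N * cmod (fourier_coeff (\<sigma> k) p) \<le>
        (real CARD('n) * (1 + \<bar>p $ j\<bar>)) ^ N * cmod (fourier_coeff (\<sigma> k) p)"
      using j by (intro mult_right_mono power_mono) auto
    also have "\<dots> = real CARD('n) ^ N * ((1 + \<bar>p $ j\<bar>) ^ N * cmod (fourier_coeff (\<sigma> k) p))"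
      by (simp only: power_mult_distrib mult.assoc)
    also have "\<dots> \<le> real CARD('n) ^ N * (C j * (1 + norm k) powr r)"
      using C(2)[OF k p] by (intro mult_left_mono) auto
    also have "\<dots> \<le> real CARD('n) ^ N * ((\<Sum>j\<in>UNIV. C j) * (1 + norm k) powr r)"
      using C(1) by (intro mult_left_mono mult_right_mono member_le_sum) auto
    finally show "(1 + norm p) ^ N * cmod (fourier_coeff (\<sigma> k) p) \<le> ?D * (1 + norm k) powr r"
      by (simp only: mult.assoc)
  qed
qed

lemma hlattice_diff:
  assumes "k \<in> hlattice h" "m \<in> hlattice h" "h \<noteq> 0"
  shows "(1 / h) *\<^sub>R (k - m) \<in> int_lattice"
proof -
  obtain y z where "y \<in> int_lattice" "z \<in> int_lattice" "k = h *\<^sub>R y" "m = h *\<^sub>R z"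
    using assms by (auto simp: hlattice_def)
  moreover from this have "(1 / h) *\<^sub>R (k - m) = y - z"
    using assms(3) by (simp add: scaleR_diff_right)
  ultimately show ?thesis by (simp add: int_lattice_def)
qed

text \<open>The left side is the kernel conjugated by the weights, so an unweighted bound for it
  yields the weighted one for \<open>Op\<close>. Decay of order N + M is used: N powers pay for
  Peetre's inequality, and M remain for summation.\<close>

lemma weighted_kernel_bound:
  fixes \<sigma> :: "real ^ 'n::finite \<Rightarrow> real ^ 'n \<Rightarrow> complex"
  assumes h: "0 < h" "h \<le> 1" and \<sigma>: "\<sigma> \<in> symbol_class h r"
  obtains C where "0 \<le> C" and "\<And>k m. k \<in> hlattice h \<Longrightarrow> m \<in> hlattice h \<Longrightarrow>
    (1 + norm k) powr (s - r) * cmod (op_kernel h \<sigma> k m) * (1 + norm m) powr - s \<le>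
      C * (1 / (1 + norm ((1 / h) *\<^sub>R (k - m))) ^ M)"
proof -
  \<comment> \<open>Rounding |s| up turns the real Peetre exponent into a natural power, valid
    because the base is at least 1.\<close>
  define N where "N = nat \<lceil>\<bar>s\<bar>\<rceil>"
  obtain C where C: "0 \<le> C" "\<And>k p. k \<in> hlattice h \<Longrightarrow> p \<in> int_lattice \<Longrightarrow>
    (1 + norm p) ^ (N + M) * cmod (fourier_coeff (\<sigma> k) p) \<le> C * (1 + norm k) powr r"
    using fourier_coeff_decay[OF \<sigma> h(1), of "N + M"] by blast
  show thesis
  proof (rule that[OF C(1)])
    fix k m :: "real ^ 'n" assume k: "k \<in> hlattice h" and m: "m \<in> hlattice h"
    define p where "p = (1 / h) *\<^sub>R (k - m)"
    have p: "p \<in> int_lattice" using hlattice_diff[OF k m] h by (simp add: p_def)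
    have pos: "0 < 1 + norm z" for z :: "real ^ 'n" by (rule add_pos_nonneg) auto
    have "norm (k - m) = h * norm p" using h by (simp add: p_def)
    also have "\<dots> \<le> norm p" using h by (simp add: mult_left_le_one_le)
    finally have "(1 + norm (k - m)) powr \<bar>s\<bar> \<le> (1 + norm p) powr \<bar>s\<bar>"
      by (intro powr_mono2) auto
    also have "\<dots> \<le> (1 + norm p) powr real N"
      by (intro powr_mono) (auto simp: N_def)
    also have "\<dots> = (1 + norm p) ^ N" using pos by (simp add: powr_realpow)
    finally have "(1 + norm k) powr s \<le> (1 + norm m) powr s * (1 + norm p) ^ N"
      using Peetre_powr[of k s m] by (meson mult_left_mono order_trans powr_ge_zero)
    then have peetre: "(1 + norm k) powr s * (1 + norm m) powr - s \<le> (1 + norm p) ^ N"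
      using pos[of m] by (simp add: powr_minus field_simps)
    \<comment> \<open>The symbol growth (1+|k|)^r restores the weight exponent s - r to s; Peetre
      then bounds the two weights by \<open>(1 + norm p) ^ N\<close>, which cancels.\<close>
    have "(1 + norm p) ^ (N + M) * ((1 + norm k) powr (s - r) * cmod (op_kernel h \<sigma> k m) * (1 + norm m) powr - s)
      = ((1 + norm k) powr (s - r) * (1 + norm m) powr - s) * ((1 + norm p) ^ (N + M) * cmod (fourier_coeff (\<sigma> k) p))"
      by (simp only: op_kernel_eq_fourier_coeff p_def mult_ac)
    also have "\<dots> \<le> ((1 + norm k) powr (s - r) * (1 + norm m) powr - s) * (C * (1 + norm k) powr r)"
      using C(2)[OF k p] by (intro mult_left_mono) auto
    also have "\<dots> = C * (((1 + norm k) powr (s - r) * (1 + norm k) powr r) * (1 + norm m) powr - s)"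
      by (simp only: mult_ac)
    also have "(1 + norm k) powr (s - r) * (1 + norm k) powr r = (1 + norm k) powr s"
      by (simp flip: powr_add)
    also have "C * ((1 + norm k) powr s * (1 + norm m) powr - s) \<le> C * (1 + norm p) ^ N"
      using peetre C(1) by (rule mult_left_mono)
    finally have "(1 + norm p) ^ N * ((1 + norm p) ^ M * ((1 + norm k) powr (s - r) * cmod (op_kernel h \<sigma> k m) * (1 + norm m) powr - s))
      \<le> (1 + norm p) ^ N * C"
      by (simp only: power_add mult_ac)
    then have "(1 + norm p) ^ M * ((1 + norm k) powr (s - r) * cmod (op_kernel h \<sigma> k m) * (1 + norm m) powr - s) \<le> C"
      using pos[of p] by (simp only: mult_le_cancel_left_pos zero_less_power)
    then show "(1 + norm k) powr (s - r) * cmod (op_kernel h \<sigma> k m) * (1 + norm m) powr - s \<le>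
      C * (1 / (1 + norm ((1 / h) *\<^sub>R (k - m))) ^ M)"
      using pos[of p] unfolding p_def[symmetric] by (simp only: pos_le_divide_eq zero_less_power times_divide_eq_right mult_1_right mult_ac)
  qed
qed

theorem corollary6p9:
  fixes h r :: real and \<sigma> :: "real ^ 'n::finite \<Rightarrow> real ^ 'n \<Rightarrow> complex"
  assumes "0 < h" and "h \<le> 1"
    and "\<sigma> \<in> symbol_class h r"
  shows "\<forall>s. Op_defined_on h \<sigma> (weighted_l2 h s) \<and> bounded_weighted_l2 h s (s - r) (Op h \<sigma>)"
proof
  fix s :: real
  define M where "M = 2 * CARD('n)"
  define w where "w t k = (1 + norm k) powr t" for t and k :: "real ^ 'n"
  obtain C where C: "0 \<le> C" "\<And>k m. k \<in> hlattice h \<Longrightarrow> m \<in> hlattice h \<Longrightarrow>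
    w (s - r) k * cmod (op_kernel h \<sigma> k m) * w (- s) m \<le> C * (1 / (1 + norm ((1 / h) *\<^sub>R (k - m))) ^ M)"
    unfolding w_def using weighted_kernel_bound[OF assms, of s M] by blast
  obtain S where S: "\<And>F. finite F \<Longrightarrow> F \<subseteq> int_lattice \<Longrightarrow>
      (\<Sum>p\<in>F. 1 / (1 + norm (p :: real ^ 'n)) ^ M) \<le> S"
    unfolding M_def using sum_int_lattice_bounded by blast
  define G where "G k m = C * (1 / (1 + norm ((1 / h) *\<^sub>R (k - m))) ^ M)" for k m :: "real ^ 'n"
  \<comment> \<open>\<open>A\<close> acts on u = w(s) f, whose unweighted norm is the weighted norm
    of f; \<open>Au\<close> and \<open>A_infsum\<close> show that the result is w(s - r) times
    \<open>Op h \<sigma> f\<close>.\<close>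
  define A where "A k m = of_real (w (s - r) k) * op_kernel h \<sigma> k m * of_real (w (- s) m)" for k m
  have wpos: "0 < w t k" for t k
    unfolding w_def using add_pos_nonneg[OF zero_less_one norm_ge_zero[of k]] by simp
  have AG: "cmod (A k m) \<le> G k m" if "k \<in> hlattice h" "m \<in> hlattice h" for k m
    using C(2)[OF that] wpos[of "s - r" k] wpos[of "- s" m] by (simp add: A_def G_def norm_mult)
  have rows: "(\<Sum>m\<in>F. G k m) \<le> C * S" if "k \<in> hlattice h" "finite F" "F \<subseteq> hlattice h" for k F
  proof -
    \<comment> \<open>For fixed k, the map from m to (k - m)/h sends distinct lattice points to
      distinct integer vectors, so the bound by C S is uniform in k.\<close>
    have "inj_on (\<lambda>m. (1 / h) *\<^sub>R (k - m)) F" using assms by (auto simp: inj_on_def)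
    then have "(\<Sum>m\<in>F. G k m) = C * (\<Sum>p\<in>(\<lambda>m. (1 / h) *\<^sub>R (k - m)) ` F. 1 / (1 + norm p) ^ M)"
      by (simp add: sum.reindex G_def sum_distrib_left)
    also have "\<dots> \<le> C * S"
      using that hlattice_diff assms by (intro mult_left_mono S C(1)) auto
    finally show ?thesis .
  qed
  have cols: "(\<Sum>k\<in>F. G k m) \<le> C * S" if "m \<in> hlattice h" "finite F" "F \<subseteq> hlattice h" for m F
  proof -
    have "G k m = G m k" for k by (simp add: G_def norm_minus_commute)
    then show ?thesis using rows[OF that] by simp
  qed
  have u_eq: "(cmod (of_real (w t k) * f k))\<^sup>2 = (1 + norm k) powr (2 * t) * (cmod (f k))\<^sup>2" for t k f
    by (simp add: w_def norm_mult power_mult_distrib powr_powr mult.commute flip: powr_numeral)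
  have Au: "A k m * (of_real (w s m) * f m) = of_real (w (s - r) k) * (op_kernel h \<sigma> k m * f m)" for k m f
  proof -
    have "0 < 1 + norm m" by (rule add_pos_nonneg) auto
    then have "w (- s) m * w s m = 1" by (simp add: w_def flip: powr_add)
    then have "complex_of_real (w (- s) m) * of_real (w s m) = 1" by (metis of_real_1 of_real_mult)
    then show ?thesis by (simp add: A_def mult_ac)
  qed
  have A_infsum: "(\<Sum>\<^sub>\<infinity>m\<in>hlattice h. A k m * (of_real (w s m) * f m)) = of_real (w (s - r) k) * Op h \<sigma> f k" for k f
    unfolding Au Op_def by (rule infsum_cmult_right')
  have u_summ: "(\<lambda>k. (cmod (of_real (w s k) * f k))\<^sup>2) summable_on hlattice h" if "f \<in> weighted_l2 h s" for f
    using that unfolding u_eq weighted_l2_def by simp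
  have summ: "(\<lambda>m. op_kernel h \<sigma> k m * f m) summable_on hlattice h"
    if "f \<in> weighted_l2 h s" "k \<in> hlattice h" for f k
    using schur_test(1)[OF AG rows cols u_summ[OF that(1)] that(2)] wpos[of "s - r" k]
    unfolding Au by (simp add: summable_on_cmult_right')
  have schur: "Op h \<sigma> f \<in> weighted_l2 h (s - r)"
    "weighted_l2_norm h (s - r) (Op h \<sigma> f) \<le> \<bar>C * S\<bar> * weighted_l2_norm h s f"
    if f: "f \<in> weighted_l2 h s" for f
  proof -
    show "Op h \<sigma> f \<in> weighted_l2 h (s - r)"
      using schur_test(2)[OF AG rows cols u_summ[OF f]]
      unfolding A_infsum u_eq weighted_l2_def by simp
    have "sqrt (\<Sum>\<^sub>\<infinity>k\<in>hlattice h. (1 + norm k) powr (2 * (s - r)) * (cmod (Op h \<sigma> f k))\<^sup>2)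
      \<le> sqrt ((C * S)\<^sup>2 * (\<Sum>\<^sub>\<infinity>k\<in>hlattice h. (1 + norm k) powr (2 * s) * (cmod (f k))\<^sup>2))"
      using schur_test(3)[OF AG rows cols u_summ[OF f]]
      unfolding A_infsum u_eq by (rule real_sqrt_le_mono)
    then show "weighted_l2_norm h (s - r) (Op h \<sigma> f) \<le> \<bar>C * S\<bar> * weighted_l2_norm h s f"
      by (simp add: weighted_l2_norm_def real_sqrt_mult)
  qed
  have "Op_defined_on h \<sigma> (weighted_l2 h s)"
    unfolding Op_defined_on_def using summ by blast
  moreover have "bounded_weighted_l2 h s (s - r) (Op h \<sigma>)"
    unfolding bounded_weighted_l2_def
  proof (intro conjI ballI allI)
    show "Op h \<sigma> (\<lambda>m. f m + g m) k = Op h \<sigma> f k + Op h \<sigma> g k"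
      if "f \<in> weighted_l2 h s" "g \<in> weighted_l2 h s" "k \<in> hlattice h" for f g k
      unfolding Op_def distrib_left using that by (intro infsum_add summ)
    \<comment> \<open>On families that are not summable \<open>infsum\<close> is 0, which is
      compatible with pulling out a constant; additivity above rests on \<open>summ\<close>.\<close>
    show "Op h \<sigma> (\<lambda>m. c * f m) k = c * Op h \<sigma> f k" for c f k
      unfolding Op_def mult.left_commute[of _ c] by (rule infsum_cmult_right')
    show "\<exists>D. \<forall>f\<in>weighted_l2 h s. Op h \<sigma> f \<in> weighted_l2 h (s - r) \<and>
        weighted_l2_norm h (s - r) (Op h \<sigma> f) \<le> D * weighted_l2_norm h s f"
      using schur by blast
  qed
  ultimately show "Op_defined_on h \<sigma> (weighted_l2 h s) \<and> bounded_weighted_l2 h s (s - r) (Op h \<sigma>)" ..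
qed

end
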